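(* (1) Let $(X,r)$ be a left-non-degenerate (LND) involutive solution. A map $k\colon X\to X$ commuting with all the $\lambda_a$'s, in the sense of $$k\lambda_a=\lambda_a k\qquad\text{for all }a\in X,$$ is a reflection for $(X,r)$. (2) Let $(X,r)$ be a right-non-degenerate (RND) involutive solution. A map $k\colon X\to X$ satisfying $$\rho_{k(a)}=\rho_a\qquad\text{for all }a\in X$$ is a reflection for $(X,r)$.
   Context: Products of maps denote composition, the rightmost map being applied first. For a map $\phi\colon X^m\to X^m$, $\phi_i$ denotes the map on $X^n$ that applies $\phi$ to the $m$ consecutive coordinates starting at position $i$ and is the identity on the others. A solution $(X,r)$ is a set $X$ with a map $r\colon X\times X\to X\times X$ satisfying the Yang–Baxter equation $r_1r_2r_1=r_2r_1r_2$ on $X^3$; write $r(a,b)=(\lambda_a(b),\rho_b(a))$. It is left-non-degenerate (LND) if all maps $\lambda_a\colon X\to X$ are bijective, right-non-degenerate (RND) if all maps $\rho_b\colon X\to X$ are bijective, and involutive if $r^2=\mathrm{Id}$. A reflection for $(X,r)$ is a map $k\colon X\to X$ satisfying the reflection equation $r k_2 r k_2=k_2 r k_2 r$ on $X^2$. Part (1) is credited to earlier work [SVW18]. *)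

theory Defs
  imports Main "HOL-Library.FuncSet"
begin

text \<open>
  A set with a map is rendered by a carrier \<open>X :: 'a set\<close> and a HOL function leaving the carrier
  invariant; all identities between maps are required on the carrier only.
  \<open>X\<^sup>3\<close> is \<open>X \<times> X \<times> X\<close>, nested to the right.
\<close>

definition map1_3 :: "('a \<times> 'a \<Rightarrow> 'a \<times> 'a) \<Rightarrow> 'a \<times> 'a \<times> 'a \<Rightarrow> 'a \<times> 'a \<times> 'a" where
  "map1_3 r = (\<lambda>(a, b, c). case r (a, b) of (a', b') \<Rightarrow> (a', b', c))"

definition map2_3 :: "('a \<times> 'a \<Rightarrow> 'a \<times> 'a) \<Rightarrow> 'a \<times> 'a \<times> 'a \<Rightarrow> 'a \<times> 'a \<times> 'a" where
  "map2_3 r = (\<lambda>(a, b, c). (a, r (b, c)))"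

definition map2_2 :: "('a \<Rightarrow> 'a) \<Rightarrow> 'a \<times> 'a \<Rightarrow> 'a \<times> 'a" where
  "map2_2 k = (\<lambda>(a, b). (a, k b))"

definition ybe_solution :: "'a set \<Rightarrow> ('a \<times> 'a \<Rightarrow> 'a \<times> 'a) \<Rightarrow> bool" where
  "ybe_solution X r \<longleftrightarrow>
     r \<in> X \<times> X \<rightarrow> X \<times> X \<and>
     (\<forall>t \<in> X \<times> X \<times> X.
        (map1_3 r \<circ> map2_3 r \<circ> map1_3 r) t = (map2_3 r \<circ> map1_3 r \<circ> map2_3 r) t)"

text \<open>Thus \<open>r (a, b) = (lam r a b, rho r b a)\<close>; note the order of the arguments of \<open>rho\<close>.\<close>

definition lam :: "('a \<times> 'a \<Rightarrow> 'a \<times> 'a) \<Rightarrow> 'a \<Rightarrow> 'a \<Rightarrow> 'a" where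
  "lam r a = (\<lambda>b. fst (r (a, b)))"

definition rho :: "('a \<times> 'a \<Rightarrow> 'a \<times> 'a) \<Rightarrow> 'a \<Rightarrow> 'a \<Rightarrow> 'a" where
  "rho r b = (\<lambda>a. snd (r (a, b)))"

definition left_non_degenerate :: "'a set \<Rightarrow> ('a \<times> 'a \<Rightarrow> 'a \<times> 'a) \<Rightarrow> bool" where
  "left_non_degenerate X r \<longleftrightarrow> (\<forall>a \<in> X. bij_betw (lam r a) X X)"

definition right_non_degenerate :: "'a set \<Rightarrow> ('a \<times> 'a \<Rightarrow> 'a \<times> 'a) \<Rightarrow> bool" where
  "right_non_degenerate X r \<longleftrightarrow> (\<forall>b \<in> X. bij_betw (rho r b) X X)"

definition involutive_on :: "'a set \<Rightarrow> ('a \<times> 'a \<Rightarrow> 'a \<times> 'a) \<Rightarrow> bool" where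
  "involutive_on X r \<longleftrightarrow> (\<forall>p \<in> X \<times> X. (r \<circ> r) p = p)"

definition reflection :: "'a set \<Rightarrow> ('a \<times> 'a \<Rightarrow> 'a \<times> 'a) \<Rightarrow> ('a \<Rightarrow> 'a) \<Rightarrow> bool" where
  "reflection X r k \<longleftrightarrow>
     k \<in> X \<rightarrow> X \<and>
     (\<forall>p \<in> X \<times> X.
        (r \<circ> map2_2 k \<circ> r \<circ> map2_2 k) p = (map2_2 k \<circ> r \<circ> map2_2 k \<circ> r) p)"

end

theory Submission
  imports Defs
begin

text \<open>
  Involutivity, read off on the two coordinates, says that for all \<open>u\<close> and \<open>v\<close> in \<open>X\<close>
  \<open>lam r (lam r u v) (rho r v u) = u\<close> and \<open>rho r (rho r v u) (lam r u v) = v\<close>.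
  Under left non-degeneracy the first identity determines the second coordinate of \<open>r (u, v)\<close>
  as the preimage of \<open>u\<close> under \<open>lam r w\<close>, where \<open>w\<close> is the first coordinate; under right
  non-degeneracy the second identity determines the first coordinate as the preimage of \<open>v\<close>
  under \<open>rho r w\<close>, where \<open>w\<close> is the second coordinate. In each part of the theorem, one pair
  of coordinates is computed outright, and the other pair is then compared through these preimages.

  If \<open>k\<close> commutes with every \<open>lam r a\<close>, both sides of the reflection equation at \<open>(a, b)\<close> have first
  coordinate \<open>k a\<close>. With \<open>u = lam r a b\<close>, their second coordinates are then the preimage of
  \<open>k u\<close> under \<open>lam r (k a)\<close>, and \<open>k\<close> applied to the preimage of \<open>u\<close> under that same map; these
  agree because \<open>k\<close> commutes with it.

  If instead \<open>rho r (k b)\<close> and \<open>rho r b\<close> agree on \<open>X\<close> for all \<open>b\<close>, both sides have second coordinate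
  \<open>k b\<close>. With \<open>v = k (rho r b a)\<close>, their first coordinates are the preimages in \<open>X\<close> of \<open>v\<close> under
  \<open>rho r (k b)\<close> and \<open>rho r b\<close>; these coincide.
\<close>

lemma apply_eq_lam_rho: "r (a, b) = (lam r a b, rho r b a)"
  by (simp add: lam_def rho_def)

lemma lam_closed:
  assumes "r \<in> X \<times> X \<rightarrow> X \<times> X" "a \<in> X" "b \<in> X"
  shows "lam r a b \<in> X"
  using funcset_mem[OF assms(1), of "(a, b)"] assms by (auto simp: apply_eq_lam_rho)

lemma rho_closed:
  assumes "r \<in> X \<times> X \<rightarrow> X \<times> X" "a \<in> X" "b \<in> X"
  shows "rho r b a \<in> X"
  using funcset_mem[OF assms(1), of "(a, b)"] assms by (auto simp: apply_eq_lam_rho)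

lemma involutive_lam_rho:
  assumes "involutive_on X r" "a \<in> X" "b \<in> X"
  shows "lam r (lam r a b) (rho r b a) = a"
  using assms by (auto simp: involutive_on_def apply_eq_lam_rho[of r])

lemma involutive_rho_lam:
  assumes "involutive_on X r" "a \<in> X" "b \<in> X"
  shows "rho r (rho r b a) (lam r a b) = b"
  using assms by (auto simp: involutive_on_def apply_eq_lam_rho[of r])

lemma reflection_iff_coordinates:
  "reflection X r k \<longleftrightarrow> k \<in> X \<rightarrow> X \<and>
     (\<forall>a \<in> X. \<forall>b \<in> X.
        lam r (lam r a (k b)) (k (rho r (k b) a)) = lam r (lam r a b) (k (rho r b a)) \<and>
        rho r (k (rho r (k b) a)) (lam r a (k b)) = k (rho r (k (rho r b a)) (lam r a b)))"
  by (auto simp: reflection_def map2_2_def apply_eq_lam_rho[of r])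

text \<open>
  The commutation hypothesis pulls \<open>k\<close> out of both first coordinates, after which involutivity
  collapses each of them to \<open>k a\<close>; injectivity of \<open>lam r (k a)\<close> then decides the second
  coordinates.
\<close>

lemma reflection_if_commutes_with_lam:
  assumes r: "r \<in> X \<times> X \<rightarrow> X \<times> X" and inv: "involutive_on X r"
    and lnd: "left_non_degenerate X r" and k: "k \<in> X \<rightarrow> X"
    and comm: "\<And>a x. a \<in> X \<Longrightarrow> x \<in> X \<Longrightarrow> k (lam r a x) = lam r a (k x)"
  shows "reflection X r k"
  unfolding reflection_iff_coordinates
proof (intro conjI ballI)
  fix a b assume a: "a \<in> X" and b: "b \<in> X"
  note closed = lam_closed[OF r] rho_closed[OF r] funcset_mem[OF k]
  let ?u = "lam r a b" and ?v = "k (rho r b a)" and ?w = "k (rho r (k b) a)"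
  have first_left: "lam r (lam r a (k b)) ?w = k a"
    using comm[of "lam r a (k b)" "rho r (k b) a"] involutive_lam_rho[OF inv a, of "k b"]
    by (simp add: a b closed)
  have first_right: "lam r ?u ?v = k a"
    using comm[of ?u "rho r b a"] involutive_lam_rho[OF inv a b] by (simp add: a b closed)
  show "lam r (lam r a (k b)) ?w = lam r ?u ?v"
    by (simp add: first_left first_right)
  have "lam r (k a) (rho r ?w (lam r a (k b))) = k ?u"
    using involutive_lam_rho[OF inv, of "lam r a (k b)" ?w]
    by (simp add: a b closed first_left comm)
  also have "\<dots> = lam r (k a) (k (rho r ?v ?u))"
    using involutive_lam_rho[OF inv, of ?u ?v] comm[of "k a" "rho r ?v ?u"]
    by (simp add: a b closed first_right)
  finally have "lam r (k a) (rho r ?w (lam r a (k b))) = lam r (k a) (k (rho r ?v ?u))" .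
  moreover have "inj_on (lam r (k a)) X"
    using lnd a closed by (auto simp: left_non_degenerate_def bij_betw_def)
  ultimately show "rho r ?w (lam r a (k b)) = k (rho r ?v ?u)"
    by (auto dest!: inj_onD simp: a b closed)
qed (rule k)

text \<open>
  The hypothesis erases \<open>k\<close> from every index of \<open>rho r\<close>, so involutivity collapses both second
  coordinates to \<open>k b\<close>; injectivity of \<open>rho r b\<close> then decides the first coordinates.
\<close>

lemma reflection_if_rho_invariant:
  assumes r: "r \<in> X \<times> X \<rightarrow> X \<times> X" and inv: "involutive_on X r"
    and rnd: "right_non_degenerate X r" and k: "k \<in> X \<rightarrow> X"
    and rho_k: "\<And>a x. a \<in> X \<Longrightarrow> x \<in> X \<Longrightarrow> rho r (k a) x = rho r a x"
  shows "reflection X r k"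
  unfolding reflection_iff_coordinates
proof (intro conjI ballI)
  fix a b assume a: "a \<in> X" and b: "b \<in> X"
  note closed = lam_closed[OF r] rho_closed[OF r] funcset_mem[OF k]
  let ?u = "lam r a b" and ?u' = "lam r a (k b)" and ?v = "k (rho r b a)"
  have same_v: "k (rho r (k b) a) = ?v"
    by (simp add: a b rho_k)
  have second_left: "rho r ?v ?u' = k b"
    using involutive_rho_lam[OF inv a, of "k b"] by (simp add: a b closed rho_k)
  have second_right: "rho r ?v ?u = b"
    using involutive_rho_lam[OF inv a b] by (simp add: a b closed rho_k)
  show "rho r (k (rho r (k b) a)) ?u' = k (rho r ?v ?u)"
    by (simp only: same_v second_left second_right)
  have "rho r b (lam r ?u' ?v) = rho r (k b) (lam r ?u' ?v)"
    by (simp add: a b closed rho_k)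
  also have "\<dots> = ?v"
    using involutive_rho_lam[OF inv, of ?u' ?v] by (simp only: second_left a b closed)
  also have "\<dots> = rho r b (lam r ?u ?v)"
    using involutive_rho_lam[OF inv, of ?u ?v] by (simp only: second_right a b closed)
  finally have "rho r b (lam r ?u' ?v) = rho r b (lam r ?u ?v)" .
  moreover have "inj_on (rho r b) X"
    using rnd b by (auto simp: right_non_degenerate_def bij_betw_def)
  ultimately show "lam r ?u' (k (rho r (k b) a)) = lam r ?u ?v"
    unfolding same_v by (auto dest!: inj_onD simp: a b closed)
qed (rule k)

theorem theorem3p2:
  fixes X :: "'a set" and r :: "'a \<times> 'a \<Rightarrow> 'a \<times> 'a" and k :: "'a \<Rightarrow> 'a"
  shows "(ybe_solution X r \<and> left_non_degenerate X r \<and> involutive_on X r \<and> k \<in> X \<rightarrow> X \<and>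
            (\<forall>a \<in> X. \<forall>x \<in> X. (k \<circ> lam r a) x = (lam r a \<circ> k) x)
          \<longrightarrow> reflection X r k) \<and>
         (ybe_solution X r \<and> right_non_degenerate X r \<and> involutive_on X r \<and> k \<in> X \<rightarrow> X \<and>
            (\<forall>a \<in> X. \<forall>x \<in> X. rho r (k a) x = rho r a x)
          \<longrightarrow> reflection X r k)"
  using reflection_if_commutes_with_lam[of r X k] reflection_if_rho_invariant[of r X k]
  by (simp add: ybe_solution_def)

end
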